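(* For the square game on the square grid with $n$ winning sets, $\mathrm{SC}_2(\mathcal G_{\square},3)\ge \frac{n}{8}+o(n)$.
   Context: An $s$-of-$k$ game on a $k$-uniform hypergraph $(V,\mathcal F)$ (winning sets are $k$-element subsets of the finite set $V$), $1\le s\le k$: Maker and Breaker alternately claim unclaimed vertices, Maker first, until all are claimed; the score is the number of winning sets in which Maker claimed at least $s$ vertices (Maker maximizes, Breaker minimizes). A pairing strategy for Maker: she fixes in advance pairwise disjoint pairs of vertices and, whenever Breaker claims a vertex of a pair whose partner is unclaimed, she claims the partner (other moves arbitrary). $\mathrm{SC}_2(\mathcal H,s)$ is the largest score Maker can guarantee against every Breaker strategy using a pairing strategy. $\mathcal G_{\square}$ is the hypergraph whose vertices are the points of a finite portion of the square lattice and whose winning sets are the sets of four corners of the unit square faces, so $k=4$. Grids are assumed "two-dimensional": the number of winning sets within constant distance of the boundary is $o(n)$, where $n$ is the number of winning sets; $o(n)$ refers to $n\to\infty$ (an unspecified term of absolute value $o(n)$). *)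

theory Defs
  imports Complex_Main "HOL-Library.Landau_Symbols" "HOL-Library.Disjoint_Sets"
begin

section \<open>Maker-Breaker scoring games\<close>

text \<open>A history is the list of all vertices claimed so far, in chronological order. Maker moves at
  histories of even length. A strategy is only ever consulted at the player's own turns, but it
  is convenient to let it be defined (and legal) at every history.\<close>

type_synonym 'a strategy = "'a list \<Rightarrow> 'a"

definition history :: "'a set \<Rightarrow> 'a list \<Rightarrow> bool" where
  "history V h \<longleftrightarrow> distinct h \<and> set h \<subseteq> V"

definition legal_strategy :: "'a set \<Rightarrow> 'a strategy \<Rightarrow> bool" where
  "legal_strategy V \<sigma> \<longleftrightarrow> (\<forall>h. history V h \<and> set h \<noteq> V \<longrightarrow> \<sigma> h \<in> V - set h)"

primrec play :: "'a strategy \<Rightarrow> 'a strategy \<Rightarrow> nat \<Rightarrow> 'a list" where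
  "play \<sigma> \<tau> 0 = []"
| "play \<sigma> \<tau> (Suc i) = play \<sigma> \<tau> i @ [(if even i then \<sigma> else \<tau>) (play \<sigma> \<tau> i)]"

definition maker_set :: "'a set \<Rightarrow> 'a strategy \<Rightarrow> 'a strategy \<Rightarrow> 'a set" where
  "maker_set V \<sigma> \<tau> = {play \<sigma> \<tau> (card V) ! i | i. i < card V \<and> even i}"

definition score :: "'a set set \<Rightarrow> nat \<Rightarrow> 'a set \<Rightarrow> nat" where
  "score F s M = card {W \<in> F. s \<le> card (W \<inter> M)}"

definition pairing :: "'a set \<Rightarrow> 'a set set \<Rightarrow> bool" where
  "pairing V P \<longleftrightarrow> (\<forall>p\<in>P. p \<subseteq> V \<and> card p = 2) \<and> disjoint P"

text \<open>At a nonempty history of even length, the last vertex of the history was claimed by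
  Breaker.\<close>

definition follows_pairing :: "'a set \<Rightarrow> 'a set set \<Rightarrow> 'a strategy \<Rightarrow> bool" where
  "follows_pairing V P \<sigma> \<longleftrightarrow> legal_strategy V \<sigma> \<and>
     (\<forall>h y. history V h \<and> h \<noteq> [] \<and> even (length h) \<and> {last h, y} \<in> P \<and> y \<notin> set h
        \<longrightarrow> \<sigma> h = y)"

text \<open>The pairing leaves the other moves of Maker undetermined, so a score is guaranteed by the
  pairing only if it is reached whatever those moves are. (If Maker could also choose them
  optimally, then the empty pairing would turn every strategy into a pairing strategy.)\<close>

definition pairing_guarantees :: "'a set \<Rightarrow> 'a set set \<Rightarrow> nat \<Rightarrow> 'a set set \<Rightarrow> nat \<Rightarrow> bool" where
  "pairing_guarantees V F s P m \<longleftrightarrow>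
     (\<forall>\<sigma> \<tau>. follows_pairing V P \<sigma> \<and> legal_strategy V \<tau> \<longrightarrow> m \<le> score F s (maker_set V \<sigma> \<tau>))"

definition SC2 :: "'a set \<Rightarrow> 'a set set \<Rightarrow> nat \<Rightarrow> nat" where
  "SC2 V F s = Max {m. \<exists>P. pairing V P \<and> pairing_guarantees V F s P m}"

lemma ex_follows_pairing:
  assumes "pairing V P"
  shows "\<exists>\<sigma>. follows_pairing V P \<sigma>"
proof -
  define Q where "Q h y \<longleftrightarrow> h \<noteq> [] \<and> even (length h) \<and> {last h, y} \<in> P \<and> y \<notin> set h" for h y
  define \<sigma> where "\<sigma> h = (if \<exists>y. Q h y then SOME y. Q h y else SOME y. y \<in> V - set h)" for h
  have uniq: "y = z" if "Q h y" "Q h z" for h y z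
  proof -
    have P: "{last h, y} \<in> P" "{last h, z} \<in> P" using that by (simp_all add: Q_def)
    have "{last h, y} \<inter> {last h, z} \<noteq> {}" by simp
    then have "{last h, y} = {last h, z}"
      using assms P unfolding pairing_def by (meson disjointD)
    moreover have "last h \<noteq> y" "last h \<noteq> z"
      using that last_in_set[of h] unfolding Q_def by metis+
    ultimately show ?thesis by (auto simp: doubleton_eq_iff)
  qed
  have Qs: "\<sigma> h = y" if "Q h y" for h y
    using that uniq unfolding \<sigma>_def by (metis (mono_tags, lifting) someI_ex)
  have QV: "y \<in> V - set h" if "Q h y" for h y
    using that assms by (auto simp: Q_def pairing_def)
  have "legal_strategy V \<sigma>"
    unfolding legal_strategy_def
  proof (intro allI impI)
    fix h assume h: "history V h \<and> set h \<noteq> V"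
    show "\<sigma> h \<in> V - set h"
    proof (cases "\<exists>y. Q h y")
      case True
      then show ?thesis using Qs QV by metis
    next
      case False
      have "\<exists>y. y \<in> V - set h" using h by (auto simp: history_def)
      then have "(SOME y. y \<in> V - set h) \<in> V - set h" by (rule someI_ex)
      then show ?thesis using False by (simp add: \<sigma>_def)
    qed
  qed
  then have "follows_pairing V P \<sigma>"
    unfolding follows_pairing_def using Qs unfolding Q_def by blast
  then show ?thesis by blast
qed

lemma le_SC2_iff:
  assumes "finite F"
  shows "m \<le> SC2 V F s \<longleftrightarrow> (\<exists>P. pairing V P \<and> pairing_guarantees V F s P m)"
proof -
  define A where "A = {m. \<exists>P. pairing V P \<and> pairing_guarantees V F s P m}"
  have "m \<le> card F" if m: "m \<in> A" for m
  proof -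
    obtain P where P: "pairing V P" "pairing_guarantees V F s P m" using m unfolding A_def by blast
    obtain \<sigma> where \<sigma>: "follows_pairing V P \<sigma>" using ex_follows_pairing P by blast
    then have "m \<le> score F s (maker_set V \<sigma> \<sigma>)"
      using P unfolding pairing_guarantees_def follows_pairing_def by blast
    also have "\<dots> \<le> card F" unfolding score_def by (rule card_mono) (use assms in auto)
    finally show ?thesis .
  qed
  then have fin: "finite A" by (intro finite_subset[of A "{..card F}"]) auto
  have "0 \<in> A" 
    unfolding A_def pairing_guarantees_def mem_Collect_eq
    by (rule exI[of _ "{}"]) (simp add: pairing_def)
  then have Max: "Max A \<in> A" using fin by (intro Max_in) auto
  have down: "m \<in> A" if "M \<in> A" "m \<le> M" for m M
    using that unfolding A_def pairing_guarantees_def mem_Collect_eq by (meson order_trans)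
  have "m \<le> Max A \<longleftrightarrow> m \<in> A"
    using down[OF Max] Max_ge[OF fin] by blast
  then show ?thesis by (simp add: SC2_def A_def)
qed

section \<open>Finite portions of the square lattice\<close>

definition unit_square :: "int \<times> int \<Rightarrow> (int \<times> int) set" where
  "unit_square p = {fst p, fst p + 1} \<times> {snd p, snd p + 1}"

definition square_faces :: "(int \<times> int) set \<Rightarrow> (int \<times> int) set set" where
  "square_faces V = {Q. Q \<subseteq> V \<and> (\<exists>p. Q = unit_square p)}"

lemma square_faces_uniform:
  assumes "Q \<in> square_faces V"
  shows "Q \<subseteq> V" "card Q = 4"
proof -
  obtain p where p: "Q \<subseteq> V" "Q = unit_square p" using assms unfolding square_faces_def by blast
  show "Q \<subseteq> V" by (fact p(1))
  show "card Q = 4" unfolding p(2) unit_square_def card_cartesian_product by simp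
qed

definition lattice_dist :: "int \<times> int \<Rightarrow> int \<times> int \<Rightarrow> int" where
  "lattice_dist p q = \<bar>fst p - fst q\<bar> + \<bar>snd p - snd q\<bar>"

definition lattice_boundary :: "(int \<times> int) set \<Rightarrow> (int \<times> int) set" where
  "lattice_boundary V = {p \<in> V. \<exists>q. q \<notin> V \<and> lattice_dist p q = 1}"

definition faces_near_boundary :: "nat \<Rightarrow> (int \<times> int) set \<Rightarrow> (int \<times> int) set set" where
  "faces_near_boundary d V =
     {Q \<in> square_faces V. \<exists>p\<in>Q. \<exists>b\<in>lattice_boundary V. lattice_dist p b \<le> int d}"

text \<open>The \<open>o(n)\<close> condition only makes sense along a sequence of grids; it is required separately
  for each constant distance \<open>d\<close>, with no uniformity in \<open>d\<close>.\<close>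

definition two_dimensional :: "(nat \<Rightarrow> (int \<times> int) set) \<Rightarrow> bool" where
  "two_dimensional V \<longleftrightarrow>
     (\<forall>d. (\<lambda>m. real (card (faces_near_boundary d (V m)))) \<in> o(\<lambda>m. real (card (square_faces (V m)))))"

end

theory Submission
  imports Defs "HOL-Library.Product_Plus"
begin

text \<open>
  A Maker who follows a pairing claims at least one vertex of every pair, so it suffices to find
  pairs such that every set meeting all of them contains three corners of at least \<open>n / 8 - o(n)\<close>
  faces. Colour the lattice points by \<open>(x - y) mod 4\<close>; pair each point \<open>p\<close> of colour 0 with
  \<open>p + (2, 0)\<close> and each point \<open>p\<close> of colour 1 with \<open>p + (-1, 1)\<close>. Passing to a subset, assume that
  exactly one point of each pair is claimed. For \<open>p\<close> of colour 0, the number of scoring faces among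
  the four with lower left corners \<open>p, p + (1, 0), p + (2, 0), p + (3, 0)\<close> is then at least \<open>1 / 2\<close>
  plus a sum of three differences of the form \<open>f (p + t) - f p\<close>, where \<open>f\<close> is bounded and \<open>t\<close>
  preserves the colours. Summed over all such \<open>p\<close> away from the boundary, the differences telescope
  to a boundary term.
\<close>

section \<open>Pairing strategies\<close>

lemma length_play [simp]: "length (play \<sigma> \<tau> i) = i"
  by (induction i) auto

lemma play_nth_less:
  assumes "i < k"
  shows "play \<sigma> \<tau> k ! i = play \<sigma> \<tau> (Suc i) ! i"
  using assms
proof (induction k)
  case (Suc k)
  then show ?case by (cases "i = k") (auto simp: nth_append)
qed simp

lemma history_play:
  assumes "finite V" "legal_strategy V \<sigma>" "legal_strategy V \<tau>" "i \<le> card V"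
  shows "history V (play \<sigma> \<tau> i)"
  using assms(4)
proof (induction i)
  case (Suc i)
  let ?h = "play \<sigma> \<tau> i"
  have h: "history V ?h" using Suc by simp
  then have "card (set ?h) = i" by (simp add: history_def distinct_card)
  then have "set ?h \<noteq> V" using Suc.prems by auto
  then have "(if even i then \<sigma> else \<tau>) ?h \<in> V - set ?h"
    using assms(2,3) h unfolding legal_strategy_def by simp
  then show ?case using h by (auto simp: history_def)
qed (simp add: history_def)

text \<open>Consider the point of the pair that is claimed first. If Maker claimed it, nothing
  remains; if Breaker did, the other point is still free at Maker's next turn and the pairing forces
  her to take it.\<close>

lemma maker_set_meets_pair:
  assumes fin: "finite V" and \<sigma>: "follows_pairing V P \<sigma>" and \<tau>: "legal_strategy V \<tau>"
    and uv: "{u, v} \<in> P" "u \<noteq> v" "u \<in> V" "v \<in> V"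
  shows "u \<in> maker_set V \<sigma> \<tau> \<or> v \<in> maker_set V \<sigma> \<tau>"
proof -
  let ?N = "card V" and ?H = "play \<sigma> \<tau> (card V)"
  have hist: "history V (play \<sigma> \<tau> i)" if "i \<le> ?N" for i
    using history_play[OF fin _ \<tau> that] \<sigma> by (simp add: follows_pairing_def)
  have "card (set ?H) = ?N"
    using hist[of ?N] by (simp add: history_def distinct_card)
  then have setH: "set ?H = V"
    using hist[of ?N] fin card_subset_eq[of V "set ?H"] by (simp add: history_def)
  have mem: "?H ! i \<in> maker_set V \<sigma> \<tau>" if "i < ?N" "even i" for i
    using that by (auto simp: maker_set_def)
  \<comment> \<open>\<open>i < k\<close> serves twice: \<open>w\<close> is still free after move
    \<open>i\<close>, and since \<open>k < ?N\<close> Maker does have a move \<open>Suc i\<close>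
    with which to answer.\<close>
  have reply: "w \<in> maker_set V \<sigma> \<tau>"
    if pair: "{?H ! i, w} \<in> P" and w: "w = ?H ! k" and ik: "i < k" "k < ?N" and odd: "odd i" for i k w
  proof -
    define h where "h = play \<sigma> \<tau> (Suc i)"
    have last: "last h = ?H ! i"
      using play_nth_less[of i ?N \<sigma> \<tau>] ik by (simp add: h_def last_conv_nth nth_append)
    have pre: "h ! j = ?H ! j" if "j < Suc i" for j
      using play_nth_less[of j ?N \<sigma> \<tau>] play_nth_less[of j "Suc i" \<sigma> \<tau>] that ik by (simp add: h_def)
    have "w \<notin> set h"
    proof
      assume "w \<in> set h"
      then obtain j where "j < Suc i" "h ! j = w"
        by (metis h_def in_set_conv_nth length_play)
      moreover have "distinct ?H" using hist[of ?N] by (simp add: history_def)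
      ultimately show False
        using pre w ik by (simp add: nth_eq_iff_index_eq)
    qed
    moreover have "history V h" "h \<noteq> []" "even (length h)"
      using hist[of "Suc i"] ik odd by (auto simp: h_def)
    ultimately have "\<sigma> h = w"
      using \<sigma> pair last unfolding follows_pairing_def by auto
    moreover have "?H ! Suc i = \<sigma> h"
      using play_nth_less[of "Suc i" ?N \<sigma> \<tau>] ik odd by (simp add: h_def nth_append)
    ultimately show ?thesis using mem[of "Suc i"] ik odd by simp
  qed
  obtain i where i: "i < ?N" "?H ! i = u" using uv(3) setH by (metis in_set_conv_nth length_play)
  obtain k where k: "k < ?N" "?H ! k = v" using uv(4) setH by (metis in_set_conv_nth length_play)
  have "i \<noteq> k" using i k uv(2) by auto
  then consider "even i" | "even k" | "odd i" "i < k" | "odd k" "k < i" by linarith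
  then show ?thesis
  proof cases
    case 3
    then show ?thesis using reply[of i v k] i k uv(1) by blast
  next
    case 4
    then show ?thesis using reply[of k u i] i k uv(1) insert_commute[of u v "{}"] by metis
  qed (use mem[of i] mem[of k] i k in blast)+
qed

section \<open>Faces and boundary\<close>

lemma inj_unit_square: "inj unit_square"
proof (rule injI)
  fix p q :: "int \<times> int"
  assume eq: "unit_square p = unit_square q"
  have "p \<in> unit_square q" using eq by (auto simp: unit_square_def mem_Times_iff)
  moreover have "q \<in> unit_square p" using eq by (auto simp: unit_square_def mem_Times_iff)
  ultimately show "p = q" by (auto simp: unit_square_def mem_Times_iff prod_eq_iff)
qed

lemma unit_square_Pair:
  "unit_square (x, y) = {(x, y), (x + 1, y), (x, y + 1), (x + 1, y + 1)}"
  by (auto simp: unit_square_def)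

lemma square_faces_eq: "square_faces V = unit_square ` {p. unit_square p \<subseteq> V}"
  by (auto simp: square_faces_def)

lemma finite_square_faces: "finite V \<Longrightarrow> finite (square_faces V)"
  by (rule finite_subset[of _ "Pow V"]) (auto simp: square_faces_def)

text \<open>Follow a shortest lattice path from \<open>p\<close> to \<open>q\<close>: the last point
  before the path first leaves \<open>V\<close> lies on the boundary, and it is no farther from
  \<open>p\<close> than \<open>q\<close> is.\<close>

lemma boundary_point_between:
  assumes "p \<in> V" "q \<notin> V" "lattice_dist p q \<le> int d"
  shows "\<exists>b\<in>lattice_boundary V. lattice_dist p b \<le> int d"
  using assms
proof (induction d arbitrary: p)
  case 0
  then have "p = q" by (auto simp: lattice_dist_def prod_eq_iff)
  then show ?case using 0 by simp
next
  case (Suc d)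
  have "p \<noteq> q" using Suc by auto
  \<comment> \<open>\<open>r\<close> is the next point of such a path, which moves horizontally
    first.\<close>
  define r where "r = (if fst p < fst q then (fst p + 1, snd p) else
    if fst q < fst p then (fst p - 1, snd p) else
    if snd p < snd q then (fst p, snd p + 1) else (fst p, snd p - 1))"
  have r: "lattice_dist r q = lattice_dist p q - 1" "lattice_dist p r = 1"
    using \<open>p \<noteq> q\<close> by (auto simp: r_def lattice_dist_def prod_eq_iff)
  show ?case
  proof (cases "r \<in> V")
    case True
    then obtain b where "b \<in> lattice_boundary V" "lattice_dist r b \<le> int d"
      using Suc.IH[of r] Suc.prems r by auto
    moreover from this have "lattice_dist p b \<le> int (Suc d)"
      using r(2) by (auto simp: lattice_dist_def)
    ultimately show ?thesis by blast
  next
    case False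
    then have "p \<in> lattice_boundary V" using Suc.prems r unfolding lattice_boundary_def by blast
    then show ?thesis by (intro bexI[of _ p]) (auto simp: lattice_dist_def)
  qed
qed

text \<open>Sending a lower left corner to its face is injective, so exceptional lattice points are
  counted by the quantity that \<open>two_dimensional\<close> controls.\<close>

lemma card_le_faces_near_boundary:
  assumes "finite V"
    and "\<And>p. p \<in> B \<Longrightarrow> unit_square p \<subseteq> V \<and> (\<exists>q. q \<notin> V \<and> lattice_dist p q \<le> int d)"
  shows "card B \<le> card (faces_near_boundary d V)"
proof (rule card_inj_on_le)
  show "inj_on unit_square B" using inj_unit_square by (rule inj_on_subset) simp
  show "finite (faces_near_boundary d V)"
    by (rule finite_subset[OF _ finite_square_faces[OF assms(1)]]) (auto simp: faces_near_boundary_def)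
  have "unit_square p \<in> faces_near_boundary d V" if "p \<in> B" for p
  proof -
    have p: "p \<in> unit_square p" by (simp add: unit_square_def mem_Times_iff)
    obtain q where q: "unit_square p \<subseteq> V" "q \<notin> V" "lattice_dist p q \<le> int d"
      using assms(2) \<open>p \<in> B\<close> by blast
    then have "\<exists>b\<in>lattice_boundary V. lattice_dist p b \<le> int d"
      using p by (intro boundary_point_between[of p V q]) auto
    moreover have "unit_square p \<in> square_faces V" using q by (auto simp: square_faces_eq)
    ultimately show ?thesis using p by (auto simp: faces_near_boundary_def)
  qed
  then show "unit_square ` B \<subseteq> faces_near_boundary d V" by blast
qed

text \<open>Let T be the translate of \<open>J\<close> by \<open>t\<close>. Terms on the
  intersection of \<open>J\<close> and T cancel. The two set differences have equal size because
  translation preserves cardinality, and T - J is the image of the points \<open>p\<close> of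
  \<open>J\<close> with \<open>p + t\<close> outside \<open>J\<close>. Each leftover term costs at
  most \<open>C\<close>.\<close>

lemma sum_telescope_translate:
  fixes f :: "int \<times> int \<Rightarrow> int"
  assumes "finite J" "\<And>p. \<bar>f p\<bar> \<le> C"
  shows "(\<Sum>p\<in>J. f p - f (p + t)) \<le> 2 * C * int (card {p \<in> J. p + t \<notin> J})"
proof -
  let ?T = "(\<lambda>p. p + t) ` J" and ?B = "{p \<in> J. p + t \<notin> J}"
  have inj: "inj_on (\<lambda>p. p + t) A" for A by (simp add: inj_on_def)
  have bound: "\<bar>sum f A\<bar> \<le> C * int (card A)" for A
    using order_trans[OF sum_abs sum_bounded_above[of A "\<lambda>p. \<bar>f p\<bar>" C]] assms(2)
    by (simp add: mult.commute)
  have out: "?T - J = (\<lambda>p. p + t) ` ?B" by auto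
  have "card (?T - J) = card ?B" unfolding out by (rule card_image) (rule inj)
  moreover have "card (J - ?T) = card (?T - J)"
  proof -
    have "card ?T = card J" by (rule card_image) (rule inj)
    then show ?thesis using assms(1) card_Diff_subset_Int[of J ?T] card_Diff_subset_Int[of ?T J]
      by (simp add: Int_commute)
  qed
  moreover have "(\<Sum>p\<in>J. f p - f (p + t)) = sum f (J - ?T) - sum f (?T - J)"
  proof -
    have "(\<Sum>p\<in>J. f (p + t)) = sum f ?T" by (simp add: sum.reindex inj)
    moreover have "sum f J = sum f (J - ?T) + sum f (J \<inter> ?T)"
      by (metis assms(1) sum.Int_Diff add.commute)
    moreover have "sum f ?T = sum f (?T - J) + sum f (J \<inter> ?T)"
      by (metis assms(1) finite_imageI sum.Int_Diff add.commute Int_commute)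
    ultimately show ?thesis by (simp add: sum_subtractf)
  qed
  ultimately show ?thesis using bound[of "J - ?T"] bound[of "?T - J"] by simp
qed

section \<open>The diagonal pairing\<close>

text \<open>The shift \<open>j\<close> stays free so that colour 0 can later be made a class holding
  at least a quarter of the interior.\<close>

definition diag_class :: "int \<Rightarrow> int \<times> int \<Rightarrow> int" where
  "diag_class j p = (fst p - snd p - j) mod 4"

text \<open>Each step changes the colour by 2 modulo 4, and colours 2 and 3 undo the steps of
  colours 0 and 1; this makes \<open>partner\<close> an involution without fixed points.\<close>

definition partner :: "int \<Rightarrow> int \<times> int \<Rightarrow> int \<times> int" where
  "partner j p =
     (if diag_class j p = 0 then p + (2, 0) else if diag_class j p = 1 then p + (-1, 1)
      else if diag_class j p = 2 then p - (2, 0) else p - (-1, 1))"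

definition partner_pairs :: "int \<Rightarrow> (int \<times> int) set \<Rightarrow> (int \<times> int) set set" where
  "partner_pairs j V = {{v, partner j v} | v. v \<in> V \<and> partner j v \<in> V}"

text \<open>The value 1 marks membership in a subset of \<open>M\<close> with exactly one point in each pair, read off
  at colours 0 and 1 only, so that the antisymmetry under \<^const>\<open>partner\<close> holds unconditionally.\<close>

definition spin :: "int \<Rightarrow> (int \<times> int) set \<Rightarrow> int \<times> int \<Rightarrow> int" where
  "spin j M v =
     (if diag_class j v < 2 then if v \<in> M then 1 else -1 else if partner j v \<in> M then -1 else 1)"

lemma diag_class_cases:
  "diag_class j p = 0 \<or> diag_class j p = 1 \<or> diag_class j p = 2 \<or> diag_class j p = 3"
  using pos_mod_bound[of 4 "fst p - snd p - j"] pos_mod_sign[of 4 "fst p - snd p - j"]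
  unfolding diag_class_def by linarith

lemma diag_class_add: "diag_class j (p + t) = (diag_class j p + fst t - snd t) mod 4"
proof -
  have "fst (p + t) - snd (p + t) - j = fst p - snd p - j + (fst t - snd t)" by simp
  then show ?thesis by (simp only: diag_class_def add_diff_eq[symmetric] mod_add_left_eq)
qed

lemma diag_class_diff: "diag_class j (p - t) = (diag_class j p - fst t + snd t) mod 4"
  using diag_class_add[of j p "- t"] by simp

lemma diag_class_partner: "diag_class j (partner j p) = (diag_class j p + 2) mod 4"
  using diag_class_cases[of j p] by (auto simp: partner_def diag_class_add diag_class_diff)

lemma partner_partner [simp]: "partner j (partner j p) = p"
  using diag_class_cases[of j p]
  by (elim disjE) (simp_all add: partner_def diag_class_add diag_class_diff)

lemma partner_neq: "partner j p \<noteq> p"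
  using diag_class_partner[of j p] diag_class_cases[of j p] by auto

lemma pairing_partner_pairs: "pairing V (partner_pairs j V)"
  unfolding pairing_def
proof (intro conjI ballI disjointI)
  fix p assume "p \<in> partner_pairs j V"
  then obtain v where v: "p = {v, partner j v}" "v \<in> V" "partner j v \<in> V"
    by (auto simp: partner_pairs_def)
  then show "p \<subseteq> V" "card p = 2" using partner_neq[of j v] by auto
next
  \<comment> \<open>By the involution a pair is determined by either of its points, so pairs that
    share a point coincide.\<close>
  have eq: "p = {u, partner j u}" if "p \<in> partner_pairs j V" "u \<in> p" for p u
    using that by (auto simp: partner_pairs_def)
  fix p q assume "p \<in> partner_pairs j V" "q \<in> partner_pairs j V" "p \<noteq> q"
  then show "p \<inter> q = {}" using eq by blast
qed

lemma spin_cases: "spin j M v = 1 \<or> spin j M v = -1"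
  by (simp add: spin_def)

lemma spin_partner: "spin j M (partner j v) = - spin j M v"
  using diag_class_cases[of j v] by (auto simp: spin_def diag_class_partner)

text \<open>At colours 2 and 3, spin 1 only says that the partner is outside \<open>M\<close>;
  membership then follows because \<open>M\<close> meets the pair.\<close>

lemma spin_mem:
  assumes "spin j M v = 1" "v \<in> M \<or> partner j v \<in> M"
  shows "v \<in> M"
  using assms by (auto simp: spin_def split: if_splits)

text \<open>Four signs sum to twice the number of positive ones minus 4, so a sum of at least 2
  means at least three positive corners, all of which lie in \<open>M\<close>.\<close>

lemma face_scores_if_spin_sum:
  assumes hit: "\<And>v. v \<in> unit_square p \<Longrightarrow> v \<in> M \<or> partner j v \<in> M"
    and sum: "(\<Sum>v\<in>unit_square p. spin j M v) \<ge> 2"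
  shows "3 \<le> card (unit_square p \<inter> M)"
proof -
  let ?Q = "unit_square p" and ?A = "{v \<in> unit_square p. spin j M v = 1}"
  have fin: "finite ?Q" and card: "card ?Q = 4"
    unfolding unit_square_def card_cartesian_product by simp_all
  have "(\<Sum>v\<in>?Q. spin j M v) = (\<Sum>v\<in>?Q. 2 * of_bool (spin j M v = 1) - 1)"
    by (rule sum.cong) (use spin_cases in \<open>auto simp: of_bool_def\<close>)
  also have "\<dots> = 2 * int (card ?A) - 4"
    using fin card by (simp add: sum_subtractf flip: sum_distrib_left) (simp add: Int_def)
  finally have "3 \<le> card ?A" using sum by linarith
  also have "card ?A \<le> card (?Q \<inter> M)"
    using fin hit spin_mem by (intro card_mono) blast+
  finally show ?thesis .
qed

section \<open>The local inequality for four consecutive faces\<close>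

definition face_score :: "(int \<times> int) set \<Rightarrow> int \<times> int \<Rightarrow> int" where
  "face_score M p = of_bool (3 \<le> card (unit_square p \<inter> M))"

lemma spin_sum_face_score:
  assumes "\<And>v. v \<in> unit_square p \<Longrightarrow> v \<in> M \<or> partner j v \<in> M"
  shows "of_bool ((\<Sum>v\<in>unit_square p. spin j M v) \<ge> 2) \<le> face_score M p"
  using face_scores_if_spin_sum[OF assms] by (simp add: face_score_def)

text \<open>The potentials are a solution of the linear program whose constraints are the 128 cases of
  \<open>four_faces_inequality\<close> below, scaled by 8; they telescope along \<open>(1, 1)\<close>, \<open>(4, 0)\<close> and \<open>(3, -1)\<close>.\<close>

definition pot1 :: "(int \<times> int \<Rightarrow> int) \<Rightarrow> int \<times> int \<Rightarrow> int" where
  "pot1 s p = s p + 3 * s (p + (1, 0)) + s p * s (p + (1, 0))"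

definition pot2 :: "(int \<times> int \<Rightarrow> int) \<Rightarrow> int \<times> int \<Rightarrow> int" where
  "pot2 s p = s p - s (p + (1, 0)) - s p * s (p + (1, 0))"

definition pot3 :: "(int \<times> int \<Rightarrow> int) \<Rightarrow> int \<times> int \<Rightarrow> int" where
  "pot3 s p = s (p + (1, 0)) * (s (p + (2, 1)) - s (p + (1, 1)) + s (p + (1, 1)) * s (p + (2, 1)) - 3)"

text \<open>The signs are the spins that remain once the pairing is used: \<open>a\<close>,
  \<open>c\<close> at \<open>p\<close> and \<open>p + (1, 0)\<close>; \<open>a1\<close>,
  \<open>c1\<close> and \<open>a2\<close>, \<open>c2\<close> at the translates of these two points
  by (1, 1) and (4, 0); \<open>e\<close> at \<open>p + (4, -1)\<close>. The last three lines are the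
  differences of \<open>pot1\<close>, \<open>pot2\<close>, \<open>pot3\<close>. The ratio 4 / 8 is
  half a scoring face per four faces, hence density 1 / 8.\<close>

lemma four_faces_inequality:
  fixes a c a1 c1 e a2 c2 :: int
  assumes "a = 1 \<or> a = -1" "c = 1 \<or> c = -1" "a1 = 1 \<or> a1 = -1" "c1 = 1 \<or> c1 = -1"
    "e = 1 \<or> e = -1" "a2 = 1 \<or> a2 = -1" "c2 = 1 \<or> c2 = -1"
  shows "4 \<le> 8 * (of_bool (2 \<le> a + a1) + of_bool (2 \<le> c - a + a1 + c1)
      + of_bool (2 \<le> c1 - a - e - a1) + of_bool (2 \<le> a2 - e - a1 - c2))
    + ((a + 3 * c + a * c) - (a1 + 3 * c1 + a1 * c1))
    + ((a - c - a * c) - (a2 - c2 - a2 * c2))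
    + (c * (c1 - a1 + a1 * c1 - 3) - e * (c2 - a2 + a2 * c2 - 3))"
  using assms by (elim disjE; hypsubst; simp)

lemma local_inequality:
  assumes hit: "\<And>v. \<lbrakk>\<bar>fst v - fst p\<bar> \<le> 4; \<bar>snd v - snd p\<bar> \<le> 1\<rbrakk> \<Longrightarrow> v \<in> M \<or> partner j v \<in> M"
    and cls: "diag_class j p = 0"
  defines "s \<equiv> spin j M"
  shows "4 \<le> 8 * (\<Sum>k\<in>{0, 1, 2, 3}. face_score M (p + (k, 0)))
    + (pot1 s p - pot1 s (p + (1, 1))) + (pot2 s p - pot2 s (p + (4, 0)))
    + (pot3 s p - pot3 s (p + (3, -1)))"
proof -
  obtain x y where p: "p = (x, y)" by fastforce
  have "diag_class j (x + u, y + v) = (u - v) mod 4" for u v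
    using diag_class_add[of j p "(u, v)"] cls by (simp add: p)
  from this[of 0 1] this[of 2 0] this[of 3 0] this[of 3 1] this[of 4 1]
  have cl: "diag_class j (x, y + 1) = 3" "diag_class j (x + 2, y) = 2" "diag_class j (x + 3, y) = 3"
    "diag_class j (x + 3, y + 1) = 2" "diag_class j (x + 4, y + 1) = 3"
    by simp_all
  have sc: "s v = 1 \<or> s v = -1" for v unfolding s_def by (rule spin_cases)
  have sp: "s (partner j v) = - s v" for v by (simp add: s_def spin_partner)
  \<comment> \<open>Of the ten corners of the four faces, five have colour 2 or 3; their spins are
    replaced by negated spins at colours 0 and 1.\<close>
  have "partner j (x, y + 1) = (x + 1, y)" "partner j (x + 2, y) = (x, y)"
    "partner j (x + 3, y) = (x + 4, y - 1)" "partner j (x + 3, y + 1) = (x + 1, y + 1)"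
    "partner j (x + 4, y + 1) = (x + 5, y)"
    by (simp_all add: partner_def cl)
  then have rel: "s (x, y + 1) = - s (x + 1, y)" "s (x + 2, y) = - s (x, y)"
    "s (x + 3, y) = - s (x + 4, y - 1)" "s (x + 3, y + 1) = - s (x + 1, y + 1)"
    "s (x + 4, y + 1) = - s (x + 5, y)"
    using sp[of "(x, y + 1)"] sp[of "(x + 2, y)"] sp[of "(x + 3, y)"]
      sp[of "(x + 3, y + 1)"] sp[of "(x + 4, y + 1)"]
    by simp_all
  have fs: "of_bool (2 \<le> t) \<le> face_score M (x0, y)"
    if "x \<le> x0" "x0 \<le> x + 3" "x1 = x0 + 1" "t = s (x0, y) + s (x1, y) + s (x0, y + 1) + s (x1, y + 1)"
    for x0 x1 t
  proof -
    have "t = (\<Sum>v\<in>unit_square (x0, y). s v)" by (simp add: unit_square_Pair that)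
    moreover have "of_bool (2 \<le> (\<Sum>v\<in>unit_square (x0, y). s v)) \<le> face_score M (x0, y)"
      unfolding s_def by (rule spin_sum_face_score, rule hit) (use that in \<open>auto simp: unit_square_Pair p\<close>)
    ultimately show ?thesis by simp
  qed
  \<comment> \<open>In the first face \<open>(x + 1, y)\<close> and \<open>(x, y + 1)\<close> are
    partners, so their spins cancel.\<close>
  have f0: "of_bool (2 \<le> s (x, y) + s (x + 1, y + 1)) \<le> face_score M (x, y)"
    by (rule fs[of _ "x + 1"]) (simp_all add: rel)
  have f1: "of_bool (2 \<le> s (x + 1, y) - s (x, y) + s (x + 1, y + 1) + s (x + 2, y + 1))
      \<le> face_score M (x + 1, y)"
    by (rule fs[of _ "x + 2"]) (simp_all add: rel)
  have f2: "of_bool (2 \<le> s (x + 2, y + 1) - s (x, y) - s (x + 4, y - 1) - s (x + 1, y + 1))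
      \<le> face_score M (x + 2, y)"
    by (rule fs[of _ "x + 3"]) (simp_all add: rel)
  have f3: "of_bool (2 \<le> s (x + 4, y) - s (x + 4, y - 1) - s (x + 1, y + 1) - s (x + 5, y))
      \<le> face_score M (x + 3, y)"
    by (rule fs[of _ "x + 4"]) (simp_all add: rel)
  have spins: "4 \<le> 8 * (of_bool (2 \<le> s (x, y) + s (x + 1, y + 1))
        + of_bool (2 \<le> s (x + 1, y) - s (x, y) + s (x + 1, y + 1) + s (x + 2, y + 1))
        + of_bool (2 \<le> s (x + 2, y + 1) - s (x, y) - s (x + 4, y - 1) - s (x + 1, y + 1))
        + of_bool (2 \<le> s (x + 4, y) - s (x + 4, y - 1) - s (x + 1, y + 1) - s (x + 5, y)))
      + (pot1 s (x, y) - pot1 s (x + 1, y + 1)) + (pot2 s (x, y) - pot2 s (x + 4, y))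
      + (pot3 s (x, y) - pot3 s (x + 3, y - 1))"
    using four_faces_inequality[of "s (x, y)" "s (x + 1, y)" "s (x + 1, y + 1)" "s (x + 2, y + 1)"
        "s (x + 4, y - 1)" "s (x + 4, y)" "s (x + 5, y)",
        OF sc sc sc sc sc sc sc]
    by (simp add: pot1_def pot2_def pot3_def add.assoc)
  have faces: "(\<Sum>k\<in>{0, 1, 2, 3}. face_score M (p + (k, 0)))
      = face_score M (x, y) + face_score M (x + 1, y) + face_score M (x + 2, y) + face_score M (x + 3, y)"
    by (simp add: p)
  \<comment> \<open>The indicators carry the positive coefficient 8, so they may be replaced by the
    larger face scores.\<close>
  have combine: "4 \<le> 8 * F + P + Q + R"
    if "4 \<le> 8 * (b0 + b1 + b2 + b3) + P + Q + R" "F = g0 + g1 + g2 + g3"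
      "b0 \<le> g0" "b1 \<le> g1" "b2 \<le> g2" "b3 \<le> g3" for F P Q R b0 b1 b2 b3 g0 g1 g2 g3 :: int
    using that by (simp add: algebra_simps)
  show ?thesis using combine[OF spins faces f0 f1 f2 f3] by (simp add: p)
qed

section \<open>Summation over the interior\<close>

definition lattice_interior :: "nat \<Rightarrow> (int \<times> int) set \<Rightarrow> (int \<times> int) set" where
  "lattice_interior d V = {p. \<forall>q. lattice_dist p q \<le> int d \<longrightarrow> q \<in> V}"

lemma lattice_interior_subset: "lattice_interior d V \<subseteq> V"
proof
  fix p assume "p \<in> lattice_interior d V"
  moreover have "lattice_dist p p \<le> int d" by (simp add: lattice_dist_def)
  ultimately show "p \<in> V" unfolding lattice_interior_def by blast
qed

lemma lattice_interiorD: "\<lbrakk>p \<in> lattice_interior d V; lattice_dist p q \<le> int d\<rbrakk> \<Longrightarrow> q \<in> V"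
  unfolding lattice_interior_def by blast

lemma unit_square_subset_interior:
  assumes "p \<in> lattice_interior d V" "lattice_dist p q + 2 \<le> int d"
  shows "unit_square q \<subseteq> V"
proof
  fix v assume "v \<in> unit_square q"
  then have "lattice_dist p v \<le> lattice_dist p q + 2"
    by (auto simp: unit_square_def mem_Times_iff lattice_dist_def)
  then show "v \<in> V" using assms by (intro lattice_interiorD[OF assms(1)]) simp
qed

text \<open>A face whose lower left corner is not interior has a point outside \<open>V\<close>
  within \<open>d\<close> of that corner, so it is near the boundary.\<close>

lemma card_faces_le_interior:
  assumes "finite V"
  shows "card (square_faces V) \<le> card (lattice_interior d V) + card (faces_near_boundary d V)"
proof -
  let ?S = "{p. unit_square p \<subseteq> V}"
  have "p \<in> V" if "unit_square p \<subseteq> V" for p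
    using that by (auto simp: unit_square_def mem_Times_iff)
  then have fin: "finite ?S" by (intro finite_subset[OF _ assms]) blast
  have "card (square_faces V) = card ?S"
    unfolding square_faces_eq by (rule card_image) (rule inj_on_subset[OF inj_unit_square subset_UNIV])
  also have "\<dots> \<le> card (?S \<inter> lattice_interior d V) + card (?S - lattice_interior d V)"
    using card_Un_le[of "?S \<inter> lattice_interior d V" "?S - lattice_interior d V"] by (simp add: Int_Diff_Un)
  also have "card (?S \<inter> lattice_interior d V) \<le> card (lattice_interior d V)"
    by (rule card_mono) (use finite_subset[OF lattice_interior_subset assms] in auto)
  also have "card (?S - lattice_interior d V) \<le> card (faces_near_boundary d V)"
    by (rule card_le_faces_near_boundary[OF assms]) (auto simp: lattice_interior_def)
  finally show ?thesis by simp
qed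

text \<open>No face is counted twice: \<open>p + (k, 0)\<close> has colour \<open>k\<close>, so a
  lower left corner determines \<open>k\<close> and then \<open>p\<close>.\<close>

lemma four_faces_score_le:
  assumes fin: "finite V" and J: "\<And>p. p \<in> J \<Longrightarrow> p \<in> lattice_interior 8 V \<and> diag_class j p = 0"
  shows "(\<Sum>p\<in>J. \<Sum>k\<in>{0, 1, 2, 3}. face_score M (p + (k, 0))) \<le> int (score (square_faces V) 3 M)"
proof -
  let ?g = "\<lambda>(p, k). p + (k, 0 :: int)"
  let ?D = "J \<times> {0, 1, 2, 3 :: int}"
  have finJ: "finite J"
    using J lattice_interior_subset[of 8 V] by (intro finite_subset[OF _ fin]) blast
  have cl: "diag_class j (p + (k, 0)) = k" if "(p, k) \<in> ?D" for p k
    using that J by (auto simp: diag_class_add)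
  have inj: "inj_on ?g ?D"
  proof (rule inj_onI)
    fix a b assume ab: "a \<in> ?D" "b \<in> ?D" "?g a = ?g b"
    obtain p k q l where pq: "a = (p, k)" "b = (q, l)" by (meson surj_pair)
    then have "k = l" using ab cl[of p k] cl[of q l] by simp
    then show "a = b" using ab(3) pq by simp
  qed
  have face: "unit_square q \<in> square_faces V" if "q \<in> ?g ` ?D" for q
  proof -
    from that obtain x where x: "x \<in> ?D" "q = ?g x" by blast
    obtain p k where "x = (p, k)" by (cases x)
    then have pk: "q = p + (k, 0)" "p \<in> J" "k \<in> {0, 1, 2, 3}" using x by simp_all
    have "lattice_dist p q \<le> 3" using pk by (auto simp: lattice_dist_def)
    then have "unit_square q \<subseteq> V" using pk J by (intro unit_square_subset_interior[of p 8]) auto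
    then show ?thesis by (auto simp: square_faces_eq)
  qed
  have "(\<Sum>p\<in>J. \<Sum>k\<in>{0, 1, 2, 3}. face_score M (p + (k, 0))) = (\<Sum>x\<in>?D. face_score M (?g x))"
    using finJ by (simp add: sum.cartesian_product case_prod_unfold del: sum.insert)
  also have "\<dots> = (\<Sum>q\<in>?g ` ?D. face_score M q)" using inj by (simp add: sum.reindex)
  also have "\<dots> = int (card {q \<in> ?g ` ?D. 3 \<le> card (unit_square q \<inter> M)})"
    using finJ by (simp add: face_score_def Int_def)
  also have "\<dots> \<le> int (score (square_faces V) 3 M)"
    unfolding score_def of_nat_le_iff
  proof (rule card_inj_on_le)
    show "inj_on unit_square {q \<in> ?g ` ?D. 3 \<le> card (unit_square q \<inter> M)}"
      by (rule inj_on_subset[OF inj_unit_square subset_UNIV])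
    show "unit_square ` {q \<in> ?g ` ?D. 3 \<le> card (unit_square q \<inter> M)}
        \<subseteq> {W \<in> square_faces V. 3 \<le> card (W \<inter> M)}"
      using face by blast
    show "finite {W \<in> square_faces V. 3 \<le> card (W \<inter> M)}"
      using finite_square_faces[OF fin] by simp
  qed
  finally show ?thesis .
qed

lemma pot_bounds:
  assumes "\<And>v. s v = 1 \<or> s v = -1"
  shows "\<bar>pot1 s p\<bar> \<le> 5" "\<bar>pot2 s p\<bar> \<le> 3" "\<bar>pot3 s p\<bar> \<le> 6"
  using assms[of p] assms[of "p + (1, 0)"] assms[of "p + (1, 1)"] assms[of "p + (2, 1)"]
  unfolding pot1_def pot2_def pot3_def by (elim disjE; simp only:; simp)+

text \<open>The local inequality is summed over \<open>J\<close>; each potential difference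
  telescopes because its translation preserves colour 0.\<close>

lemma score_ge_class_card:
  assumes fin: "finite V" and hit: "\<And>v. v \<in> V \<Longrightarrow> partner j v \<in> V \<Longrightarrow> v \<in> M \<or> partner j v \<in> M"
  defines "J \<equiv> {p \<in> lattice_interior 8 V. diag_class j p = 0}"
  shows "4 * card J \<le> 8 * score (square_faces V) 3 M + 28 * card (faces_near_boundary 12 V)"
proof -
  define s where "s = spin j M"
  have s: "s v = 1 \<or> s v = -1" for v unfolding s_def by (rule spin_cases)
  let ?N = "int (card (faces_near_boundary 12 V))"
  have finJ: "finite J"
    using lattice_interior_subset[of 8 V] unfolding J_def by (intro finite_subset[OF _ fin]) blast
  have tele: "(\<Sum>p\<in>J. f p - f (p + t)) \<le> 2 * C * ?N"
    if f: "\<And>p. \<bar>f p\<bar> \<le> C" and t: "\<bar>fst t\<bar> + \<bar>snd t\<bar> \<le> 4" "(fst t - snd t) mod 4 = 0" for f C t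
  proof -
    have "card {p \<in> J. p + t \<notin> J} \<le> card (faces_near_boundary 12 V)"
    proof (rule card_le_faces_near_boundary[OF fin])
      fix p assume p: "p \<in> {p \<in> J. p + t \<notin> J}"
      then have int: "p \<in> lattice_interior 8 V" by (simp add: J_def)
      \<comment> \<open>The translate keeps colour 0, so it leaves \<open>J\<close> only by leaving
        the interior. It is then within 8 of the complement, and \<open>p\<close> within 8 + 4 =
        12.\<close>
      have "diag_class j (p + t) = 0" using p t(2) by (simp add: J_def diag_class_add)
      then obtain q where q: "q \<notin> V" "lattice_dist (p + t) q \<le> 8"
        using p by (auto simp: J_def lattice_interior_def)
      then have "lattice_dist p q \<le> int 12" using t(1) by (simp add: lattice_dist_def)
      moreover have "unit_square p \<subseteq> V"
        by (rule unit_square_subset_interior[OF int]) (simp add: lattice_dist_def)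
      ultimately show "unit_square p \<subseteq> V \<and> (\<exists>q. q \<notin> V \<and> lattice_dist p q \<le> int 12)" using q by blast
    qed
    moreover have "0 \<le> C" using f[of 0] by simp
    ultimately have "2 * C * int (card {p \<in> J. p + t \<notin> J}) \<le> 2 * C * ?N"
      by (intro mult_left_mono) simp_all
    then show ?thesis using sum_telescope_translate[of J f C t, OF finJ f] by linarith
  qed
  have loc: "4 \<le> 8 * (\<Sum>k\<in>{0, 1, 2, 3}. face_score M (p + (k, 0)))
    + (pot1 s p - pot1 s (p + (1, 1))) + (pot2 s p - pot2 s (p + (4, 0)))
    + (pot3 s p - pot3 s (p + (3, -1)))" if p: "p \<in> J" for p
  proof -
    have int: "p \<in> lattice_interior 8 V" and cls: "diag_class j p = 0" using p by (simp_all add: J_def)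
    have "v \<in> M \<or> partner j v \<in> M" if v: "\<bar>fst v - fst p\<bar> \<le> 4" "\<bar>snd v - snd p\<bar> \<le> 1" for v
    proof (rule hit)
      \<comment> \<open>Depth 8 suffices: \<open>v\<close> is within 5 of \<open>p\<close>, and a
        partner is at most 2 further away.\<close>
      show "v \<in> V" using v by (intro lattice_interiorD[OF int]) (simp add: lattice_dist_def)
      show "partner j v \<in> V"
        using v by (intro lattice_interiorD[OF int]) (auto simp: lattice_dist_def partner_def)
    qed
    from local_inequality[of p M j, OF this cls] show ?thesis unfolding s_def .
  qed
  have "4 * int (card J) = (\<Sum>p\<in>J. 4)" by simp
  also have "\<dots> \<le> (\<Sum>p\<in>J. 8 * (\<Sum>k\<in>{0, 1, 2, 3}. face_score M (p + (k, 0)))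
    + (pot1 s p - pot1 s (p + (1, 1))) + (pot2 s p - pot2 s (p + (4, 0)))
    + (pot3 s p - pot3 s (p + (3, -1))))"
    using loc by (rule sum_mono)
  also have "\<dots> = 8 * (\<Sum>p\<in>J. \<Sum>k\<in>{0, 1, 2, 3}. face_score M (p + (k, 0)))
    + (\<Sum>p\<in>J. pot1 s p - pot1 s (p + (1, 1))) + (\<Sum>p\<in>J. pot2 s p - pot2 s (p + (4, 0)))
    + (\<Sum>p\<in>J. pot3 s p - pot3 s (p + (3, -1)))"
    by (simp only: sum.distrib sum_distrib_left)
  \<comment> \<open>The bounds 5, 3, 6 on the potentials give the constant 28 = 2 * (5 + 3 +
    6).\<close>
  also have "\<dots> \<le> 8 * int (score (square_faces V) 3 M) + 2 * 5 * ?N + 2 * 3 * ?N + 2 * 6 * ?N"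
  proof -
    have "(\<Sum>p\<in>J. \<Sum>k\<in>{0, 1, 2, 3}. face_score M (p + (k, 0))) \<le> int (score (square_faces V) 3 M)"
      by (rule four_faces_score_le[OF fin, of J j]) (simp add: J_def)
    moreover have "(\<Sum>p\<in>J. pot1 s p - pot1 s (p + (1, 1))) \<le> 2 * 5 * ?N"
      by (rule tele) (simp_all add: pot_bounds s)
    moreover have "(\<Sum>p\<in>J. pot2 s p - pot2 s (p + (4, 0))) \<le> 2 * 3 * ?N"
      by (rule tele) (simp_all add: pot_bounds s)
    moreover have "(\<Sum>p\<in>J. pot3 s p - pot3 s (p + (3, -1))) \<le> 2 * 6 * ?N"
      by (rule tele) (simp_all add: pot_bounds s)
    ultimately show ?thesis by linarith
  qed
  finally show ?thesis by linarith
qed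

section \<open>Choice of the colouring and the asymptotic bound\<close>

text \<open>Pigeonhole over the four shifts; the sizes of the colour classes need not be compared
  with each other.\<close>

lemma ex_large_diag_class:
  assumes "finite I"
  shows "\<exists>j. card I \<le> 4 * card {p \<in> I. diag_class j p = 0}"
proof (rule ccontr)
  assume "\<not> ?thesis"
  then have less: "4 * card {p \<in> I. diag_class j p = 0} < card I" for j by (simp add: not_le)
  have "I \<subseteq> (\<Union>j\<in>{0, 1, 2, 3}. {p \<in> I. diag_class j p = 0})"
  proof
    fix p assume "p \<in> I"
    \<comment> \<open>Shifting by the unshifted colour of \<open>p\<close> gives \<open>p\<close>
      colour 0.\<close>
    moreover have "diag_class (diag_class 0 p) p = 0"
      by (simp add: diag_class_def mod_diff_right_eq)
    ultimately show "p \<in> (\<Union>j\<in>{0, 1, 2, 3}. {p \<in> I. diag_class j p = 0})"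
      using diag_class_cases[of 0 p] by auto
  qed
  then have "card I \<le> card (\<Union>j\<in>{0, 1, 2, 3}. {p \<in> I. diag_class j p = 0})"
    using assms by (intro card_mono) auto
  also have "\<dots> \<le> (\<Sum>j\<in>{0, 1, 2, 3}. card {p \<in> I. diag_class j p = 0})"
    by (rule card_UN_le) simp
  finally show False using less[of 0] less[of 1] less[of 2] less[of 3] by simp
qed

lemma SC2_square_faces_ge:
  assumes fin: "finite V"
  shows "card (square_faces V) \<le> 8 * SC2 V (square_faces V) 3 + 29 * card (faces_near_boundary 12 V)"
proof -
  let ?n = "card (square_faces V)" and ?N = "card (faces_near_boundary 12 V)"
  have "finite (lattice_interior 8 V)"
    using lattice_interior_subset fin by (rule finite_subset)
  then obtain j where j: "card (lattice_interior 8 V) \<le> 4 * card {p \<in> lattice_interior 8 V. diag_class j p = 0}"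
    using ex_large_diag_class by blast
  have sub: "faces_near_boundary 8 V \<subseteq> faces_near_boundary 12 V"
    by (force simp: faces_near_boundary_def)
  have "finite (faces_near_boundary 12 V)"
    by (rule finite_subset[OF _ finite_square_faces[OF fin]]) (auto simp: faces_near_boundary_def)
  then have "card (faces_near_boundary 8 V) \<le> ?N" using sub by (rule card_mono)
  \<comment> \<open>This \<open>?N\<close>, for the faces without an interior corner, is added to
    the 28 from telescoping and makes 29.\<close>
  then have n: "?n \<le> 4 * card {p \<in> lattice_interior 8 V. diag_class j p = 0} + ?N"
    using card_faces_le_interior[OF fin, of 8] j by linarith
  \<comment> \<open>Adding 7 rounds the quotient up, so that
    \<open>?n \<le> 8 * m + 29 * ?N\<close>; truncated subtraction makes \<open>m\<close> zero when
    \<open>?n \<le> 29 * ?N\<close>.\<close>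
  define m where "m = (?n - 29 * ?N + 7) div 8"
  have "pairing_guarantees V (square_faces V) 3 (partner_pairs j V) m"
    unfolding pairing_guarantees_def
  proof (intro allI impI, elim conjE)
    fix \<sigma> \<tau> assume \<sigma>: "follows_pairing V (partner_pairs j V) \<sigma>" and \<tau>: "legal_strategy V \<tau>"
    have "v \<in> maker_set V \<sigma> \<tau> \<or> partner j v \<in> maker_set V \<sigma> \<tau>" if "v \<in> V" "partner j v \<in> V" for v
    proof (rule maker_set_meets_pair[OF fin \<sigma> \<tau>])
      show "{v, partner j v} \<in> partner_pairs j V" using that unfolding partner_pairs_def by blast
    qed (use that partner_neq[of j v] in auto)
    then have "?n \<le> 8 * score (square_faces V) 3 (maker_set V \<sigma> \<tau>) + 29 * ?N"
      using score_ge_class_card[OF fin, of j "maker_set V \<sigma> \<tau>"] n by simp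
    then show "m \<le> score (square_faces V) 3 (maker_set V \<sigma> \<tau>)" unfolding m_def by linarith
  qed
  then have "m \<le> SC2 V (square_faces V) 3"
    using le_SC2_iff[OF finite_square_faces[OF fin]] pairing_partner_pairs by blast
  then show ?thesis unfolding m_def by linarith
qed

theorem theorem11:
  fixes V :: "nat \<Rightarrow> (int \<times> int) set" and n :: "nat \<Rightarrow> nat"
  assumes "\<And>m. finite (V m)"
    and "\<And>m. n m = card (square_faces (V m))"
    and "filterlim n at_top sequentially"
    and "two_dimensional V"
  shows "\<exists>e :: nat \<Rightarrow> real. e \<in> o(\<lambda>m. real (n m)) \<and>
           (\<forall>m. real (SC2 (V m) (square_faces (V m)) 3) \<ge> real (n m) / 8 + e m)"
proof (intro exI conjI allI)
  let ?N = "\<lambda>m. real (card (faces_near_boundary 12 (V m)))"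
  \<comment> \<open>The distance 12 is the same for all grids, so \<open>two_dimensional\<close>
    applies with \<open>d = 12\<close>.\<close>
  have "?N \<in> o(\<lambda>m. real (n m))"
    using assms(4) by (simp add: two_dimensional_def assms(2))
  then show "(\<lambda>m. - (29 / 8) * ?N m) \<in> o(\<lambda>m. real (n m))"
    by (rule landau_o.small.cmult_in_iff[THEN iffD2, rotated]) simp
  fix m
  have "real (n m) \<le> real (8 * SC2 (V m) (square_faces (V m)) 3 + 29 * card (faces_near_boundary 12 (V m)))"
    unfolding of_nat_le_iff assms(2) by (rule SC2_square_faces_ge[OF assms(1)])
  then show "real (n m) / 8 + - (29 / 8) * ?N m \<le> real (SC2 (V m) (square_faces (V m)) 3)"
    by simp
qed

end
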